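(* Let $L\ge 2$ and consider the open spin chain Hamiltonian on $(\mathbb C^2)^{\otimes L}$ $$H_{\rm open}=\sum_{i=1}^{L-1}H_{i\,i+1},$$ where $H_{i\,i+1}$ denotes $H=B\otimes C$ acting on the tensor factors $i$ and $i+1$ (and as the identity on the other factors). Define the $L+1$ operators $$B_i=\underbrace{D\otimes\cdots\otimes D}_{i-1}\otimes B\otimes \underbrace{1\otimes\cdots\otimes1}_{L-i}\quad(1\le i\le L),\qquad B_{L+1}=\underbrace{D\otimes\cdots\otimes D}_{L}.$$ Then each $B_j$, $j=1,\dots,L+1$, commutes with $H_{\rm open}$, and the $B_j$ satisfy the Clifford algebra relations $$B_iB_j+B_jB_i=2\delta_{ij}\qquad (i,j\in\{1,\dots,L+1\}).$$
   Context: $B=\begin{pmatrix}0&1\\1&0\end{pmatrix}$, $C=\begin{pmatrix}0&1\\-1&0\end{pmatrix}$, $D=\begin{pmatrix}1&0\\0&-1\end{pmatrix}$, and $1$ denotes the $2\times2$ identity matrix. *)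

theory Defs
  imports Complex_Main "Jordan_Normal_Form.Matrix"
begin

text \<open>Operators on the \<open>L\<close>-fold tensor power of \<open>\<complex>\<^sup>2\<close> are matrices of dimension \<open>2 ^ L\<close> over \<open>complex\<close>,
  written in the product basis; the leftmost tensor factor is the most significant index digit.\<close>

definition kron :: "complex mat \<Rightarrow> complex mat \<Rightarrow> complex mat" (infixr "\<otimes>\<^sub>m" 75) where
  "X \<otimes>\<^sub>m Y = mat (dim_row X * dim_row Y) (dim_col X * dim_col Y)
     (\<lambda>(r, c). X $$ (r div dim_row Y, c div dim_col Y) * Y $$ (r mod dim_row Y, c mod dim_col Y))"

definition kron_list :: "complex mat list \<Rightarrow> complex mat" where
  "kron_list Xs = foldr (\<otimes>\<^sub>m) Xs (1\<^sub>m 1)"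

definition matB :: "complex mat" where
  "matB = mat_of_rows_list 2 [[0, 1], [1, 0]]"

definition matC :: "complex mat" where
  "matC = mat_of_rows_list 2 [[0, 1], [-1, 0]]"

definition matD :: "complex mat" where
  "matD = mat_of_rows_list 2 [[1, 0], [0, -1]]"

definition Hloc :: "complex mat" where
  "Hloc = matB \<otimes>\<^sub>m matC"

definition Hsite :: "nat \<Rightarrow> nat \<Rightarrow> complex mat" where
  "Hsite L i = kron_list (replicate (i - 1) (1\<^sub>m 2) @ [Hloc] @ replicate (L - 1 - i) (1\<^sub>m 2))"

definition Hopen :: "nat \<Rightarrow> complex mat" where
  "Hopen L = finsum (ring_mat TYPE(complex) (2 ^ L) ()) (Hsite L) {1..L - 1}"

definition Bop :: "nat \<Rightarrow> nat \<Rightarrow> complex mat" where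
  "Bop L i = (if i \<le> L
     then kron_list (replicate (i - 1) matD @ [matB] @ replicate (L - i) (1\<^sub>m 2))
     else kron_list (replicate L matD))"

lemma dim_kron [simp]:
  "dim_row (X \<otimes>\<^sub>m Y) = dim_row X * dim_row Y"
  "dim_col (X \<otimes>\<^sub>m Y) = dim_col X * dim_col Y"
  by (simp_all add: kron_def)

lemma dim_kron_list:
  "dim_row (kron_list Xs) = prod_list (map dim_row Xs)"
  "dim_col (kron_list Xs) = prod_list (map dim_col Xs)"
  by (induction Xs) (simp_all add: kron_list_def)

lemma dim_matBCD [simp]:
  "dim_row matB = 2" "dim_col matB = 2"
  "dim_row matC = 2" "dim_col matC = 2"
  "dim_row matD = 2" "dim_col matD = 2"
  by (simp_all add: matB_def matC_def matD_def mat_of_rows_list_def)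

lemma Hsite_carrier:
  assumes "1 \<le> i" "i < L"
  shows "Hsite L i \<in> carrier_mat (2 ^ L) (2 ^ L)"
proof -
  have "(2::nat) ^ (i - 1) * (4 * 2 ^ (L - 1 - i)) = 2 ^ ((i - 1) + 2 + (L - 1 - i))"
    by (simp add: power_add)
  also have "(i - 1) + 2 + (L - 1 - i) = L"
    using assms by simp
  finally show ?thesis
    by (intro carrier_matI) (simp_all add: Hsite_def Hloc_def dim_kron_list)
qed

lemma Bop_carrier:
  assumes "1 \<le> j"
  shows "Bop L j \<in> carrier_mat (2 ^ L) (2 ^ L)"
proof -
  have "(2::nat) ^ (j - 1) * (2 * 2 ^ (L - j)) = 2 ^ L" if "j \<le> L"
  proof -
    have "(2::nat) ^ (j - 1) * (2 * 2 ^ (L - j)) = 2 ^ ((j - 1) + 1 + (L - j))"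
      by (simp add: power_add)
    also have "(j - 1) + 1 + (L - j) = L"
      using assms that by simp
    finally show ?thesis .
  qed
  then show ?thesis
    by (intro carrier_matI) (simp_all add: Bop_def dim_kron_list)
qed

lemma Hopen_carrier: "Hopen L \<in> carrier_mat (2 ^ L) (2 ^ L)"
proof -
  interpret ring "ring_mat TYPE(complex) (2 ^ L) ()"
    by (rule ring_mat)
  have "Hsite L \<in> {1..L - 1} \<rightarrow> carrier (ring_mat TYPE(complex) (2 ^ L) ())"
    using Hsite_carrier by (auto simp: ring_mat_simps)
  from finsum_closed[OF this] show ?thesis
    by (simp add: Hopen_def ring_mat_simps)
qed

end

theory Submission
  imports Defs
begin

text \<open>All operators involved are tensor products of one-site operators taken from the identity,
  \<open>B\<close>, \<open>C\<close>, \<open>D\<close>, and any two of these commute up to a sign. By the mixed product rule two tensor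
  products therefore commute up to the product of the one-site signs. For \<open>B\<^sub>i\<close> and \<open>B\<^sub>j\<close>
  with \<open>i < j\<close> exactly one sign (at site \<open>i\<close>) is \<open>-1\<close>; for \<open>B\<^sub>j\<close> and \<open>H\<^sub>i\<^sub>,\<^sub>i\<^sub>+\<^sub>1\<close> the signs
  at sites \<open>i\<close> and \<open>i + 1\<close> are both \<open>-1\<close> if \<open>j > i\<close> and both \<open>1\<close> otherwise.\<close>

section \<open>Algebra of the Kronecker product\<close>

text \<open>Quotient and remainder by \<open>m\<close> identify the indices below
  \<open>n * m\<close> with pairs of indices. This splits the inner summation index in a product of
  two Kronecker products.\<close>

lemma sum_lessThan_mult_div_mod:
  fixes f :: "nat \<Rightarrow> nat \<Rightarrow> 'a::comm_monoid_add"
  shows "(\<Sum>k<n * m. f (k div m) (k mod m)) = (\<Sum>a<n. \<Sum>b<m. f a b)"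
proof -
  have "(\<Sum>k<n * m. f (k div m) (k mod m))
      = (\<Sum>a<n. \<Sum>k = a * m..<a * m + m. f (k div m) (k mod m))"
    by (simp add: sum.nat_group)
  also have "\<dots> = (\<Sum>a<n. \<Sum>b<m. f a b)"
  proof (rule sum.cong [OF refl])
    fix a
    have "(\<Sum>k = a * m..<a * m + m. f (k div m) (k mod m))
        = (\<Sum>b = 0..<m. f ((b + a * m) div m) ((b + a * m) mod m))"
      using sum.shift_bounds_nat_ivl [of "\<lambda>k. f (k div m) (k mod m)" 0 "a * m" m]
      by (simp add: add.commute)
    also have "\<dots> = (\<Sum>b<m. f a b)"
      by (rule sum.cong) auto
    finally show "(\<Sum>k = a * m..<a * m + m. f (k div m) (k mod m)) = (\<Sum>b<m. f a b)" .
  qed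
  finally show ?thesis .
qed

lemma index_kron:
  assumes "r < dim_row X * dim_row Y" "c < dim_col X * dim_col Y"
  shows "(X \<otimes>\<^sub>m Y) $$ (r, c)
    = X $$ (r div dim_row Y, c div dim_col Y) * Y $$ (r mod dim_row Y, c mod dim_col Y)"
  using assms by (simp add: kron_def)

lemma div_mod_less_factors:
  fixes r n m :: nat
  assumes "r < n * m"
  shows "r div m < n" "r mod m < m"
proof -
  have "m > 0" using assms by (cases m) auto
  then show "r div m < n" "r mod m < m"
    using assms by (auto simp: less_mult_imp_div_less)
qed

text \<open>The mixed product rule: once the inner index is split into its two digits, the double
  sum factors into one sum per tensor factor.\<close>

lemma kron_mult:
  assumes "X \<in> carrier_mat a n" "X' \<in> carrier_mat n c" "Y \<in> carrier_mat b m" "Y' \<in> carrier_mat m d"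
  shows "(X \<otimes>\<^sub>m Y) * (X' \<otimes>\<^sub>m Y') = (X * X') \<otimes>\<^sub>m (Y * Y')"
proof (rule eq_matI)
  fix r s
  assume "r < dim_row ((X * X') \<otimes>\<^sub>m (Y * Y'))" "s < dim_col ((X * X') \<otimes>\<^sub>m (Y * Y'))"
  then have rs: "r < a * b" "s < c * d" using assms by auto
  note lt = div_mod_less_factors [OF rs(1)] div_mod_less_factors [OF rs(2)]
  have "((X \<otimes>\<^sub>m Y) * (X' \<otimes>\<^sub>m Y')) $$ (r, s)
      = (\<Sum>k<n * m. (X \<otimes>\<^sub>m Y) $$ (r, k) * (X' \<otimes>\<^sub>m Y') $$ (k, s))"
    using assms rs by (simp add: scalar_prod_def lessThan_atLeast0)
  also have "\<dots> = (\<Sum>k<n * m. (X $$ (r div b, k div m) * Y $$ (r mod b, k mod m))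
      * (X' $$ (k div m, s div d) * Y' $$ (k mod m, s mod d)))"
    using assms rs by (intro sum.cong) (auto simp: index_kron)
  also have "\<dots> = (\<Sum>k<n. \<Sum>l<m. (X $$ (r div b, k) * Y $$ (r mod b, l))
      * (X' $$ (k, s div d) * Y' $$ (l, s mod d)))"
    by (rule sum_lessThan_mult_div_mod)
  also have "\<dots> = (\<Sum>k<n. X $$ (r div b, k) * X' $$ (k, s div d))
      * (\<Sum>l<m. Y $$ (r mod b, l) * Y' $$ (l, s mod d))"
    by (simp add: sum_product mult_ac)
  also have "\<dots> = ((X * X') \<otimes>\<^sub>m (Y * Y')) $$ (r, s)"
    using assms rs lt by (simp add: index_kron scalar_prod_def lessThan_atLeast0)
  finally show "((X \<otimes>\<^sub>m Y) * (X' \<otimes>\<^sub>m Y')) $$ (r, s) = ((X * X') \<otimes>\<^sub>m (Y * Y')) $$ (r, s)" .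
qed (use assms in auto)

lemma kron_carrier:
  assumes "X \<in> carrier_mat a b" "Y \<in> carrier_mat c d"
  shows "X \<otimes>\<^sub>m Y \<in> carrier_mat (a * c) (b * d)"
  using assms by (auto intro: carrier_matI)

lemma kron_smult_smult: "(s \<cdot>\<^sub>m X) \<otimes>\<^sub>m (t \<cdot>\<^sub>m Y) = (s * t) \<cdot>\<^sub>m (X \<otimes>\<^sub>m Y)"
  by (rule eq_matI) (auto simp: index_kron div_mod_less_factors)

text \<open>Both bracketings read off the same three mixed-radix digits of each index;
  \<open>digits\<close> compares the two ways of extracting them.\<close>

lemma kron_assoc: "(X \<otimes>\<^sub>m Y) \<otimes>\<^sub>m Z = X \<otimes>\<^sub>m (Y \<otimes>\<^sub>m Z)"
proof (rule eq_matI)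
  fix r c
  assume "r < dim_row (X \<otimes>\<^sub>m (Y \<otimes>\<^sub>m Z))" "c < dim_col (X \<otimes>\<^sub>m (Y \<otimes>\<^sub>m Z))"
  then have r: "r < dim_row X * dim_row Y * dim_row Z" and c: "c < dim_col X * dim_col Y * dim_col Z"
    by (simp_all add: mult.assoc)
  have r': "r < dim_row X * (dim_row Y * dim_row Z)" and c': "c < dim_col X * (dim_col Y * dim_col Z)"
    using r c by (simp_all add: mult.assoc)
  have digits: "k mod (m * n) div n = k div n mod m" "k mod (m * n) mod n = k mod n"
    "k div (m * n) = k div n div m" for k m n :: nat
    by (simp_all add: div_mult2_eq mod_mult2_eq mult.commute [of m n])
       (cases "n = 0", auto)
  show "((X \<otimes>\<^sub>m Y) \<otimes>\<^sub>m Z) $$ (r, c) = (X \<otimes>\<^sub>m (Y \<otimes>\<^sub>m Z)) $$ (r, c)"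
    using div_mod_less_factors [OF r] div_mod_less_factors [OF c]
      div_mod_less_factors [OF r'] div_mod_less_factors [OF c'] r c r' c'
    by (simp add: index_kron digits mult.assoc)
qed (simp_all add: mult.assoc)

lemma one_kron_one: "1\<^sub>m n \<otimes>\<^sub>m 1\<^sub>m m = 1\<^sub>m (n * m)"
proof (rule eq_matI)
  fix r c
  assume "r < dim_row (1\<^sub>m (n * m) :: complex mat)" "c < dim_col (1\<^sub>m (n * m) :: complex mat)"
  then have rc: "r < n * m" "c < n * m" by auto
  have "r = c \<longleftrightarrow> r div m = c div m \<and> r mod m = c mod m"
    by (metis div_mult_mod_eq)
  then show "(1\<^sub>m n \<otimes>\<^sub>m 1\<^sub>m m) $$ (r, c) = 1\<^sub>m (n * m) $$ (r, c)"
    using rc div_mod_less_factors [OF rc(1)] div_mod_less_factors [OF rc(2)]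
    by (auto simp: index_kron)
qed auto

section \<open>Iterated Kronecker products\<close>

lemma kron_list_simps:
  "kron_list [] = 1\<^sub>m 1" "kron_list (X # Xs) = X \<otimes>\<^sub>m kron_list Xs"
  by (simp_all add: kron_list_def)

text \<open>\<open>Hsite\<close> lists the two-site block \<open>Hloc\<close> as a single entry of
  size 4; splitting it yields one factor per site, aligned with those of \<open>Bop\<close>.\<close>

lemma kron_list_append_kron:
  "kron_list (Xs @ (Y \<otimes>\<^sub>m Z) # Zs) = kron_list (Xs @ Y # Z # Zs)"
  by (induction Xs) (simp_all add: kron_list_simps kron_assoc)

lemma kron_list_map_carrier:
  assumes "\<And>k. f k \<in> carrier_mat n n"
  shows "kron_list (map f ks) \<in> carrier_mat (n ^ length ks) (n ^ length ks)"
  using assms by (induction ks) (auto simp: kron_list_simps intro: kron_carrier)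

lemma kron_list_mult:
  assumes "\<And>k. f k \<in> carrier_mat n n" "\<And>k. g k \<in> carrier_mat n n"
  shows "kron_list (map f ks) * kron_list (map g ks) = kron_list (map (\<lambda>k. f k * g k) ks)"
proof (induction ks)
  case (Cons k ks)
  then show ?case
    using kron_mult [OF assms(1) [of k] assms(2) [of k]
        kron_list_map_carrier [of f, OF assms(1)] kron_list_map_carrier [of g, OF assms(2)]]
    by (simp add: kron_list_simps)
qed (simp add: kron_list_simps)

lemma kron_list_smult:
  "kron_list (map (\<lambda>k. s k \<cdot>\<^sub>m f k) ks) = prod_list (map s ks) \<cdot>\<^sub>m kron_list (map f ks)"
  by (induction ks) (auto simp: kron_list_simps kron_smult_smult)

lemma kron_list_one: "kron_list (map (\<lambda>k. 1\<^sub>m n) ks) = 1\<^sub>m (n ^ length ks)"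
  by (induction ks) (auto simp: kron_list_simps one_kron_one)

text \<open>The mixed product rule reduces both orders to sitewise products, and the one-site
  scalars then multiply to a global one. Giving the factors as functions of the site keeps the two
  tensor products aligned.\<close>

lemma kron_list_commute_upto_sign:
  assumes "\<And>k. f k \<in> carrier_mat n n" "\<And>k. g k \<in> carrier_mat n n"
    and "\<And>k. f k * g k = s k \<cdot>\<^sub>m (g k * f k)"
  shows "kron_list (map f [0..<L]) * kron_list (map g [0..<L])
    = (\<Prod>k<L. s k) \<cdot>\<^sub>m (kron_list (map g [0..<L]) * kron_list (map f [0..<L]))"
proof -
  have "prod_list (map s [0..<L]) = (\<Prod>k<L. s k)"
    by (simp add: prod.distinct_set_conv_list [symmetric] lessThan_atLeast0)
  then show ?thesis
    using assms(3) by (simp add: kron_list_mult [of f n g, OF assms(1,2)]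
        kron_list_mult [of g n f, OF assms(2,1)]
        kron_list_smult)
qed

section \<open>One-site matrices and the factors of the operators\<close>

lemma matBCD_carrier [simp]:
  "matB \<in> carrier_mat 2 2" "matC \<in> carrier_mat 2 2" "matD \<in> carrier_mat 2 2"
  by (auto intro: carrier_matI)

text \<open>The anticommutation of \<open>matB\<close> and \<open>matD\<close> is recorded in both
  orders because it is used as a directed rewrite rule.\<close>

lemma matBCD_mult:
  "matB * matB = 1\<^sub>m 2" "matD * matD = 1\<^sub>m 2"
  "matB * matD = (-1) \<cdot>\<^sub>m (matD * matB)" "matD * matB = (-1) \<cdot>\<^sub>m (matB * matD)"
  "matB * matC = (-1) \<cdot>\<^sub>m (matC * matB)" "matD * matC = (-1) \<cdot>\<^sub>m (matC * matD)"
  by (rule eq_matI;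
      auto simp: matB_def matC_def matD_def mat_of_rows_list_def scalar_prod_def less_Suc_eq numeral_2_eq_2)+

text \<open>The site index \<open>k\<close> starts at \<open>0\<close>, whereas \<open>i\<close> and \<open>j\<close> are numbered from \<open>1\<close> as in the paper.\<close>

definition Bfactor :: "nat \<Rightarrow> nat \<Rightarrow> complex mat" where
  "Bfactor j k = (if k < j - 1 then matD else if k = j - 1 then matB else 1\<^sub>m 2)"

definition Hfactor :: "nat \<Rightarrow> nat \<Rightarrow> complex mat" where
  "Hfactor i k = (if k = i - 1 then matB else if k = i then matC else 1\<^sub>m 2)"

lemma Bfactor_carrier: "Bfactor j k \<in> carrier_mat 2 2"
  by (simp add: Bfactor_def)

lemma Hfactor_carrier: "Hfactor i k \<in> carrier_mat 2 2"
  by (simp add: Hfactor_def)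

lemma Bop_eq_kron_list:
  assumes "1 \<le> j" "j \<le> L + 1"
  shows "Bop L j = kron_list (map (Bfactor j) [0..<L])"
proof (cases "j \<le> L")
  case True
  have "replicate (j - 1) matD @ [matB] @ replicate (L - j) (1\<^sub>m 2) = map (Bfactor j) [0..<L]"
    using True assms
    by (intro nth_equalityI) (auto simp: Bfactor_def nth_append nth_Cons')
  then show ?thesis using True by (simp add: Bop_def)
next
  case False
  \<comment> \<open>Here \<open>j = L + 1\<close>, so the position \<open>j - 1\<close> of
    \<open>matB\<close> falls just past the last site and only \<open>matD\<close> occurs.\<close>
  have "replicate L matD = map (Bfactor j) [0..<L]"
    using False assms by (intro nth_equalityI) (auto simp: Bfactor_def)
  then show ?thesis using False by (simp add: Bop_def)
qed

lemma Hsite_eq_kron_list: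
  assumes "1 \<le> i" "i < L"
  shows "Hsite L i = kron_list (map (Hfactor i) [0..<L])"
proof -
  have "replicate (i - 1) (1\<^sub>m 2) @ matB # matC # replicate (L - 1 - i) (1\<^sub>m 2)
      = map (Hfactor i) [0..<L]"
    using assms by (intro nth_equalityI) (auto simp: Hfactor_def nth_append nth_Cons')
  then show ?thesis
    by (simp add: Hsite_def Hloc_def kron_list_append_kron)
qed

section \<open>Commutation relations of the operators\<close>

lemma Bop_anticommute:
  assumes "1 \<le> i" "i < j" "j \<le> L + 1"
  shows "Bop L i * Bop L j = (-1) \<cdot>\<^sub>m (Bop L j * Bop L i)"
proof -
  \<comment> \<open>Before site \<open>i - 1\<close> both factors are \<open>matD\<close>, at it
    \<open>matB\<close> meets \<open>matD\<close>, and after it the first factor is the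
    identity.\<close>
  have "Bfactor i k * Bfactor j k
      = (if k = i - 1 then -1 else 1) \<cdot>\<^sub>m (Bfactor j k * Bfactor i k)" for k
    using assms by (auto simp: Bfactor_def matBCD_mult(3))
  from kron_list_commute_upto_sign [of "Bfactor i" 2 "Bfactor j", OF Bfactor_carrier Bfactor_carrier this,
      where L = L]
  \<comment> \<open>The exceptional site lies inside the chain, so its sign really occurs in the
    product over \<open>k < L\<close>.\<close>
  moreover have "i - 1 < L" using assms by simp
  ultimately show ?thesis
    using assms by (simp add: Bop_eq_kron_list)
qed

lemma Bop_square:
  assumes "1 \<le> j" "j \<le> L + 1"
  shows "Bop L j * Bop L j = 1\<^sub>m (2 ^ L)"
proof -
  have "Bfactor j k * Bfactor j k = 1\<^sub>m 2" for k
    by (simp add: Bfactor_def matBCD_mult)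
  then show ?thesis
    using assms kron_list_one [of 2 "[0..<L]"]
    by (simp add: Bop_eq_kron_list kron_list_mult [of "Bfactor j" 2 "Bfactor j", OF Bfactor_carrier Bfactor_carrier])
qed

lemma Bop_commute_Hsite:
  assumes "1 \<le> j" "j \<le> L + 1" "1 \<le> i" "i < L"
  shows "Bop L j * Hsite L i = Hsite L i * Bop L j"
proof -
  \<comment> \<open>The common sign at sites \<open>i - 1\<close> and \<open>i\<close>. In the
    borderline case \<open>j = i + 1\<close> the pair at site \<open>i\<close> is
    \<open>matB\<close> against \<open>matC\<close>, which still anticommutes.\<close>
  define s :: complex where "s = (if i < j then -1 else 1)"
  \<comment> \<open>Writing the sign as a product of two conditionals lets
    \<open>prod.distrib\<close> separate the two sites; each contributes one \<open>s\<close>, and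
    \<open>s * s = 1\<close>.\<close>
  have "Bfactor j k * Hfactor i k = ((if k = i - 1 then s else 1) * (if k = i then s else 1))
      \<cdot>\<^sub>m (Hfactor i k * Bfactor j k)" for k
    using assms by (auto simp: Bfactor_def Hfactor_def s_def matBCD_mult(4-6))
  from kron_list_commute_upto_sign [of "Bfactor j" 2 "Hfactor i", OF Bfactor_carrier Hfactor_carrier this,
      where L = L]
  moreover have "i - 1 < L" "s * s = 1" using assms by (simp_all add: s_def)
  moreover have "1 \<cdot>\<^sub>m A = A" for A :: "complex mat" by auto
  ultimately show ?thesis
    using assms by (simp add: Bop_eq_kron_list Hsite_eq_kron_list prod.distrib)
qed

text \<open>\<open>Hopen\<close> is a \<open>finsum\<close> in the matrix ring, so distributivity
  from the left and from the right reduces the claim to its summands.\<close>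

lemma Bop_commute_Hopen:
  assumes "1 \<le> j" "j \<le> L + 1"
  shows "Bop L j * Hopen L = Hopen L * Bop L j"
proof -
  let ?R = "ring_mat TYPE(complex) (2 ^ L) ()"
  interpret R: ring ?R
    by (rule ring_mat)
  have H: "Hsite L \<in> {1..L - 1} \<rightarrow> carrier ?R"
    using Hsite_carrier by (auto simp: ring_mat_simps)
  have B: "Bop L j \<in> carrier ?R"
    using Bop_carrier assms by (simp add: ring_mat_simps)
  have "Bop L j \<otimes>\<^bsub>?R\<^esub> Hopen L = finsum ?R (\<lambda>i. Bop L j \<otimes>\<^bsub>?R\<^esub> Hsite L i) {1..L - 1}"
    unfolding Hopen_def using H B by (simp add: R.finsum_rdistr)
  also have "\<dots> = finsum ?R (\<lambda>i. Hsite L i \<otimes>\<^bsub>?R\<^esub> Bop L j) {1..L - 1}"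
  proof (rule R.finsum_cong' [OF refl])
    show "(\<lambda>i. Hsite L i \<otimes>\<^bsub>?R\<^esub> Bop L j) \<in> {1..L - 1} \<rightarrow> carrier ?R"
      using H B by auto
    show "Bop L j \<otimes>\<^bsub>?R\<^esub> Hsite L i = Hsite L i \<otimes>\<^bsub>?R\<^esub> Bop L j" if "i \<in> {1..L - 1}" for i
      using that assms by (auto simp: ring_mat_simps intro!: Bop_commute_Hsite)
  qed
  also have "\<dots> = Hopen L \<otimes>\<^bsub>?R\<^esub> Bop L j"
    unfolding Hopen_def using H B by (simp add: R.finsum_ldistr)
  finally show ?thesis
    by (simp add: ring_mat_simps)
qed

text \<open>Both orders of the summands are stated, so that the assumption \<open>i < j\<close> also
  serves pairs of indices in decreasing order.\<close>

lemma Bop_anticommutator: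
  assumes "1 \<le> i" "i < j" "j \<le> L + 1"
  shows "Bop L i * Bop L j + Bop L j * Bop L i = 0\<^sub>m (2 ^ L) (2 ^ L)"
    and "Bop L j * Bop L i + Bop L i * Bop L j = 0\<^sub>m (2 ^ L) (2 ^ L)"
  using Bop_carrier [of i L] Bop_carrier [of j L] assms
  by (auto simp: Bop_anticommute [OF assms] intro!: eq_matI)

theorem mainTheorem4:
  fixes L :: nat
  assumes "L \<ge> 2"
  shows "(\<forall>j\<in>{1..L + 1}. Bop L j * Hopen L = Hopen L * Bop L j)
    \<and> (\<forall>i\<in>{1..L + 1}. \<forall>j\<in>{1..L + 1}.
         Bop L i * Bop L j + Bop L j * Bop L i
         = (if i = j then 2 else 0) \<cdot>\<^sub>m 1\<^sub>m (2 ^ L))"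
proof (intro conjI ballI)
  fix j assume "j \<in> {1..L + 1}"
  then show "Bop L j * Hopen L = Hopen L * Bop L j"
    by (simp add: Bop_commute_Hopen)
next
  fix i j assume ij: "i \<in> {1..L + 1}" "j \<in> {1..L + 1}"
  show "Bop L i * Bop L j + Bop L j * Bop L i = (if i = j then 2 else 0) \<cdot>\<^sub>m 1\<^sub>m (2 ^ L)"
  proof (cases i j rule: linorder_cases)
    case less
    then show ?thesis using ij Bop_anticommutator(1) [of i j L] by (auto intro!: eq_matI)
  next
    case equal
    then show ?thesis using ij Bop_square [of j L] by (auto intro!: eq_matI)
  next
    case greater
    then show ?thesis using ij Bop_anticommutator(2) [of j i L] by (auto intro!: eq_matI)
  qed
qed

end
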